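(* Let $X$ be a path-connected normal ENR (Euclidean neighbourhood retract), and let $q\colon X\times X\to Y$ be a closed continuous map with $Y$ paracompact. Suppose further that $\mathsf{TC}_X(q^{-1}(y))\leq n$ for each $y\in Y$. Then \[ \mathsf{TC}(X)\leq(\dim Y+1)\cdot n. \]
   Context: For a path-connected space $X$, let $\mathscr{P}X=\{\gamma\colon [0,1]\to X\}$ be the space of continuous paths in $X$ with the compact-open topology, and let $\pi\colon\mathscr{P}X\to X\times X$, $\pi(\gamma)=(\gamma(0),\gamma(1))$. For a subspace $A\subseteq X\times X$, the subspace topological complexity $\mathsf{TC}_X(A)$ is the smallest integer $k\ge 0$ such that $A$ can be covered by $k$ sets $U_1,\dots,U_k$, open in $A$, each admitting a continuous map $s_i\colon U_i\to\mathscr{P}X$ with $\pi\circ s_i$ equal to the inclusion $U_i\hookrightarrow X\times X$; it is $\infty$ if no such integer exists (and $\mathsf{TC}_X(\emptyset)=0$). The topological complexity is $\mathsf{TC}(X)=\mathsf{TC}_X(X\times X)$ (not reduced: $\mathsf{TC}(\text{point})=1$). A map is closed if it sends closed sets to closed sets. $\dim Y$ denotes the covering dimension of $Y$. *)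

theory Defs
  imports "HOL-Analysis.Analysis"
begin

text \<open>Functions between carriers are represented by their extensional representatives
  (value \<^term>\<open>undefined\<close> outside the domain), so that each continuous map of topological
  spaces is exactly one point of the mapping space.\<close>

definition compact_open_topology ::
    "'a topology \<Rightarrow> 'b topology \<Rightarrow> ('a \<Rightarrow> 'b) topology" where
  "compact_open_topology T X =
     topology_generated_by
       {{f \<in> extensional (topspace T). continuous_map T X f \<and> f ` K \<subseteq> V} | K V.
          compactin T K \<and> openin X V}"

definition path_space :: "'a topology \<Rightarrow> (real \<Rightarrow> 'a) topology" where
  "path_space X = compact_open_topology (top_of_set {0..1::real}) X"

definition endpoints :: "(real \<Rightarrow> 'a) \<Rightarrow> 'a \<times> 'a" where
  "endpoints \<gamma> = (\<gamma> 0, \<gamma> 1)"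

text \<open>The infimum in \<^typ>\<open>enat\<close> of the empty set is \<open>\<infinity>\<close>.\<close>

definition subspace_TC :: "'a topology \<Rightarrow> ('a \<times> 'a) set \<Rightarrow> enat" where
  "subspace_TC X A =
     Inf {enat k | k. \<exists>U :: nat \<Rightarrow> ('a \<times> 'a) set.
        (\<Union>i<k. U i) = A \<and>
        (\<forall>i<k. openin (subtopology (prod_topology X X) A) (U i) \<and>
           (\<exists>s. continuous_map (subtopology (prod_topology X X) (U i)) (path_space X) s \<and>
                (\<forall>p \<in> U i. endpoints (s p) = p)))}"

definition TC :: "'a topology \<Rightarrow> enat" where
  "TC X = subspace_TC X (topspace X \<times> topspace X)"

definition open_cover_of :: "'a topology \<Rightarrow> 'a set set \<Rightarrow> bool" where
  "open_cover_of Y \<U> \<longleftrightarrow> (\<forall>U \<in> \<U>. openin Y U) \<and> \<Union>\<U> = topspace Y"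

definition refines :: "'a set set \<Rightarrow> 'a set set \<Rightarrow> bool" where
  "refines \<V> \<U> \<longleftrightarrow> (\<forall>V \<in> \<V>. \<exists>U \<in> \<U>. V \<subseteq> U)"

text \<open>No separation axiom is included.\<close>

definition paracompact_space :: "'a topology \<Rightarrow> bool" where
  "paracompact_space Y \<longleftrightarrow>
     (\<forall>\<U>. open_cover_of Y \<U> \<longrightarrow>
        (\<exists>\<V>. open_cover_of Y \<V> \<and> refines \<V> \<U> \<and> locally_finite_in Y \<V>))"

text \<open>Arbitrary (not only finite) open covers are refined; for paracompact Hausdorff spaces
  the two versions agree.  The empty space gets dimension \<open>0\<close> instead of \<open>-1\<close>, since the
  values are in \<^typ>\<open>enat\<close>.\<close>

definition covering_dim :: "'a topology \<Rightarrow> enat" where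
  "covering_dim Y =
     Inf {enat d | d. \<forall>\<U>. open_cover_of Y \<U> \<longrightarrow>
        (\<exists>\<V>. open_cover_of Y \<V> \<and> refines \<V> \<U> \<and>
             (\<forall>y \<in> topspace Y. finite {V \<in> \<V>. y \<in> V} \<and> card {V \<in> \<V>. y \<in> V} \<le> d + 1))}"

end

theory Submission
  imports Defs
begin

text \<open>By the exponential law, a section over \<open>U\<close> is a homotopy \<open>U \<times> [0,1] \<rightarrow> X\<close> with prescribed ends.
  Each fibre \<open>A\<close> over the image of \<open>q\<close> is closed, because points of \<open>X \<times> X\<close> have closed images, and
  since \<open>X\<close> is an ANR, a section over an open piece of \<open>A\<close> extends to an open subset of \<open>X \<times> X\<close>. So \<open>n\<close>
  open sets with sections cover a neighbourhood of \<open>A\<close>, which contains the preimage of a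
  neighbourhood of the point because \<open>q\<close> is closed. A refinement of order \<open>dim Y + 1\<close> of the
  resulting cover of \<open>Y\<close> is pulled back to the metrizable space \<open>X \<times> X\<close> and regrouped there into
  \<open>dim Y + 1\<close> families of disjoint open sets; on each family the sections are glued.\<close>

section \<open>Exponential law: sections into the path space as homotopies\<close>

definition planner :: "'a topology \<Rightarrow> ('a \<times> 'a) set \<Rightarrow> bool" where
  "planner X U \<longleftrightarrow>
     (\<exists>H. continuous_map
            (prod_topology (subtopology (prod_topology X X) U) (top_of_set {0..1::real})) X H \<and>
          (\<forall>p\<in>U. H (p, 0) = fst p \<and> H (p, 1) = snd p))"

text \<open>The compact set \<open>K = {}\<close> imposes no condition, so its subbasic set already
  consists of all paths.\<close>

lemma topspace_path_space:
  "topspace (path_space X) =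
     {f \<in> extensional {0..1}. continuous_map (top_of_set {0..1::real}) X f}"
  unfolding path_space_def compact_open_topology_def topology_generated_by_topspace
  by (rule antisym, fastforce, rule Union_upper, clarsimp)
    (rule exI[of _ "{}"], rule exI[of _ "topspace X"], auto)

lemma openin_path_space_subbasic:
  assumes "compact K" "K \<subseteq> {0..1::real}" "openin X V"
  shows "openin (path_space X)
           {f \<in> extensional {0..1}. continuous_map (top_of_set {0..1}) X f \<and> f ` K \<subseteq> V}"
  unfolding path_space_def compact_open_topology_def
  by (rule topology_generated_by_Basis) (use assms in \<open>auto simp: compactin_subtopology\<close>)

text \<open>This direction rests on local compactness of [0,1]: around each time there is a compact
  neighbourhood \<open>K\<close> that the path \<open>s p\<close> carries into \<open>V\<close>, and
  the subbasic set of \<open>K\<close> and \<open>V\<close> then controls all paths near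
  \<open>s p\<close> on all of \<open>K\<close> at once.\<close>

lemma continuous_map_uncurry_path_space:
  assumes s: "continuous_map T (path_space X) s"
  shows "continuous_map (prod_topology T (top_of_set {0..1::real})) X (\<lambda>(p, t). s p t)"
proof -
  have path: "continuous_map (top_of_set {0..1}) X (s p)" if "p \<in> topspace T" for p
    using continuous_map_image_subset_topspace[OF s] that by (auto simp: topspace_path_space)
  show ?thesis
    unfolding continuous_map_alt
  proof (intro conjI allI impI)
    show "(\<lambda>(p, t). s p t) \<in> topspace (prod_topology T (top_of_set {0..1})) \<rightarrow> topspace X"
      using continuous_map_image_subset_topspace[OF path] by fastforce
  next
    fix V assume V: "openin X V"
    show "openin (prod_topology T (top_of_set {0..1::real}))
            ((\<lambda>(p, t). s p t) -` V \<inter> topspace (prod_topology T (top_of_set {0..1})))"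
      unfolding openin_prod_topology_alt
    proof (intro allI impI)
      fix p t
      assume "(p, t) \<in> (\<lambda>(p, t). s p t) -` V \<inter> topspace (prod_topology T (top_of_set {0..1::real}))"
      then have p: "p \<in> topspace T" and t: "t \<in> {0..1}" and pV: "s p t \<in> V"
        by auto
      have "openin (top_of_set {0..1}) {u \<in> {0..1}. s p u \<in> V}"
        using openin_continuous_map_preimage[OF path[OF p] V] by simp
      \<comment> \<open>A closed ball is taken because its trace \<open>K\<close> on [0,1] has to be
        compact; the open ball inside it serves as the neighbourhood of \<open>t\<close>.\<close>
      then obtain e where e: "e > 0" "cball t e \<inter> {0..1} \<subseteq> {u \<in> {0..1}. s p u \<in> V}"
        using t pV unfolding openin_contains_cball by blast
      define K where "K = cball t e \<inter> {0..1}"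
      define O1 where "O1 = {p' \<in> topspace T. s p' \<in>
          {f \<in> extensional {0..1}. continuous_map (top_of_set {0..1}) X f \<and> f ` K \<subseteq> V}}"
      have "compact K" "K \<subseteq> {0..1}"
        unfolding K_def by (auto intro: compact_Int)
      then have "openin T O1"
        unfolding O1_def
        using openin_continuous_map_preimage[OF s] openin_path_space_subbasic V by blast
      moreover have "p \<in> O1"
        using p path[OF p] e continuous_map_image_subset_topspace[OF s]
        by (auto simp: O1_def K_def topspace_path_space)
      moreover have "openin (top_of_set {0..1}) (ball t e \<inter> {0..1})"
        by (metis Int_commute openin_open open_ball)
      moreover have "O1 \<times> (ball t e \<inter> {0..1})
          \<subseteq> (\<lambda>(p, t). s p t) -` V \<inter> topspace (prod_topology T (top_of_set {0..1}))"
        using ball_subset_cball[of t e] by (fastforce simp: O1_def K_def)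
      ultimately show "\<exists>U W. openin T U \<and> openin (top_of_set {0..1}) W \<and> p \<in> U \<and> t \<in> W \<and>
          U \<times> W \<subseteq> (\<lambda>(p, t). s p t) -` V \<inter> topspace (prod_topology T (top_of_set {0..1}))"
        using t e(1) by (metis IntI centre_in_ball)
    qed
  qed
qed

text \<open>Only preimages of subbasic sets have to be open, and there the tube lemma along the
  compact \<open>K\<close> applies. Restricting to [0,1] yields the extensional representative,
  which is what a point of the path space is.\<close>

lemma continuous_map_curry_path_space:
  assumes H: "continuous_map (prod_topology T (top_of_set {0..1::real})) X H"
  shows "continuous_map T (path_space X) (\<lambda>p. \<lambda>t\<in>{0..1}. H (p, t))"
proof -
  let ?s = "\<lambda>p. \<lambda>t\<in>{0..1::real}. H (p, t)"
  have path: "continuous_map (top_of_set {0..1}) X (?s p)" if p: "p \<in> topspace T" for p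
  proof -
    have "continuous_map (top_of_set {0..1}) (prod_topology T (top_of_set {0..1::real})) (\<lambda>t. (p, t))"
      using p by (simp add: continuous_map_pairwise o_def)
    from continuous_map_compose[OF this H] show ?thesis
      by (rule continuous_map_eq) simp
  qed
  have inter: "openin T (?s -` {f \<in> extensional {0..1}. continuous_map (top_of_set {0..1}) X f \<and> f ` K \<subseteq> V}
      \<inter> topspace T)" (is "openin T ?P")
    if K: "compactin (top_of_set {0..1}) K" and V: "openin X V" for K V
  proof (subst openin_subopen, intro ballI)
    fix p assume "p \<in> ?P"
    then have p: "p \<in> topspace T" and pK: "?s p ` K \<subseteq> V"
      by auto
    have K01: "K \<subseteq> {0..1}"
      using compactin_subset_topspace[OF K] by simp
    have "{p} \<times> K \<subseteq> {z \<in> topspace (prod_topology T (top_of_set {0..1})). H z \<in> V}"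
      using p pK K01 by (auto simp: image_subset_iff subset_iff)
    from tube_lemma_right[OF openin_continuous_map_preimage[OF H V] K p this]
    obtain A B where AB: "openin T A" "p \<in> A" "K \<subseteq> B"
      "A \<times> B \<subseteq> {z \<in> topspace (prod_topology T (top_of_set {0..1})). H z \<in> V}"
      by blast
    have "A \<subseteq> ?P"
    proof
      fix a assume a: "a \<in> A"
      then have "a \<in> topspace T"
        using AB(1) openin_subset by blast
      moreover have "?s a ` K \<subseteq> V"
      proof (clarify)
        fix t assume "t \<in> K"
        then have "(a, t) \<in> A \<times> B" "t \<in> {0..1}"
          using a AB K01 by auto
        then show "?s a t \<in> V"
          using AB(4) by auto
      qed
      ultimately show "a \<in> ?P"
        using path by simp
    qed
    then show "\<exists>A. openin T A \<and> p \<in> A \<and> A \<subseteq> ?P"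
      using AB by blast
  qed
  show ?thesis
    unfolding path_space_def compact_open_topology_def
  proof (rule continuous_on_generated_topo)
    fix U
    assume "U \<in> {{f \<in> extensional (topspace (top_of_set {0..1::real})).
        continuous_map (top_of_set {0..1}) X f \<and> f ` K \<subseteq> V} |K V.
        compactin (top_of_set {0..1}) K \<and> openin X V}"
    then show "openin T (?s -` U \<inter> topspace T)"
      using inter by auto
  next
    have "?s ` topspace T \<subseteq> topspace (path_space X)"
      using path by (auto simp: topspace_path_space)
    then show "?s ` topspace T \<subseteq> \<Union> {{f \<in> extensional (topspace (top_of_set {0..1::real})).
        continuous_map (top_of_set {0..1}) X f \<and> f ` K \<subseteq> V} |K V.
        compactin (top_of_set {0..1}) K \<and> openin X V}"
      unfolding path_space_def compact_open_topology_def topology_generated_by_topspace .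
  qed
qed

lemma planner_iff_section:
  assumes "U \<subseteq> topspace (prod_topology X X)"
  shows "planner X U \<longleftrightarrow>
    (\<exists>s. continuous_map (subtopology (prod_topology X X) U) (path_space X) s \<and>
         (\<forall>p\<in>U. endpoints (s p) = p))"
proof
  assume "planner X U"
  then obtain H where H: "continuous_map
      (prod_topology (subtopology (prod_topology X X) U) (top_of_set {0..1::real})) X H"
    "\<forall>p\<in>U. H (p, 0) = fst p \<and> H (p, 1) = snd p"
    unfolding planner_def by blast
  show "\<exists>s. continuous_map (subtopology (prod_topology X X) U) (path_space X) s \<and>
         (\<forall>p\<in>U. endpoints (s p) = p)"
    by (intro exI conjI, rule continuous_map_curry_path_space[OF H(1)])
      (use H(2) in \<open>auto simp: endpoints_def\<close>)
next
  assume "\<exists>s. continuous_map (subtopology (prod_topology X X) U) (path_space X) s \<and>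
         (\<forall>p\<in>U. endpoints (s p) = p)"
  then obtain s where s: "continuous_map (subtopology (prod_topology X X) U) (path_space X) s"
    "\<forall>p\<in>U. endpoints (s p) = p"
    by blast
  show "planner X U"
    unfolding planner_def
    by (intro exI conjI, rule continuous_map_uncurry_path_space[OF s(1)])
      (use s(2) in \<open>auto simp: endpoints_def prod_eq_iff\<close>)
qed

section \<open>Restricting and gluing motion planners\<close>

lemma planner_mono:
  assumes "planner X U" "V \<subseteq> U"
  shows "planner X V"
proof -
  have "prod_topology (subtopology (prod_topology X X) V) (top_of_set {0..1::real}) =
      subtopology (prod_topology (subtopology (prod_topology X X) U) (top_of_set {0..1})) (V \<times> UNIV)"
    using assms(2)
    by (metis Times_Int_Times inf.absorb_iff2 inf_top.right_neutral subtopology_Times subtopology_UNIV subtopology_subtopology)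
  with assms show ?thesis
    unfolding planner_def by (metis continuous_map_from_subtopology subsetD)
qed

lemma planner_empty: "planner X {}"
  by (simp add: planner_def prod_topology_trivial_iff continuous_map_on_empty2)

text \<open>The pieces are open and never overlap, so the pasting lemma has nothing to reconcile.
  The index set may be infinite: this is what lets a whole disjoint family count as a single set of
  the final cover.\<close>

lemma planner_disjoint_Union:
  assumes op: "\<And>i. i \<in> I \<Longrightarrow> openin (prod_topology X X) (U i)"
    and pl: "\<And>i. i \<in> I \<Longrightarrow> planner X (U i)"
    and disj: "\<And>i j. \<lbrakk>i \<in> I; j \<in> I; i \<noteq> j\<rbrakk> \<Longrightarrow> U i \<inter> U j = {}"
  shows "planner X (\<Union>i\<in>I. U i)"
proof -
  let ?XX = "prod_topology X X" and ?I = "top_of_set {0..1::real}"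
  let ?T = "prod_topology (subtopology ?XX (\<Union>i\<in>I. U i)) ?I"
  obtain H where H: "\<And>i. i \<in> I \<Longrightarrow> continuous_map (prod_topology (subtopology ?XX (U i)) ?I) X (H i)"
    "\<And>i p. \<lbrakk>i \<in> I; p \<in> U i\<rbrakk> \<Longrightarrow> H i (p, 0) = fst p \<and> H i (p, 1) = snd p"
    using pl unfolding planner_def by metis
  define idx where "idx = (\<lambda>p. SOME i. i \<in> I \<and> p \<in> U i)"
  have idx: "idx p = i" if "i \<in> I" "p \<in> U i" for p i
    using that disj unfolding idx_def by (intro some_equality) blast+
  have "continuous_map ?T X (\<lambda>z. H (idx (fst z)) z)"
  proof (rule pasting_lemma)
    fix i assume i: "i \<in> I"
    have "openin (subtopology ?XX (\<Union>i\<in>I. U i)) (U i)"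
      using op i by (auto intro!: openin_subtopology_Int2 simp: openin_subtopology)
    then show "openin ?T (U i \<times> {0..1})"
      by (simp add: openin_prod_Times_iff)
    have "subtopology ?T (U i \<times> {0..1}) = prod_topology (subtopology ?XX (U i)) ?I"
      using i by (simp add: subtopology_Times subtopology_subtopology inf.absorb2 UN_upper)
    then show "continuous_map (subtopology ?T (U i \<times> {0..1})) X (H i)"
      using H(1)[OF i] by simp
  next
    fix i j x assume "i \<in> I" "j \<in> I" "x \<in> topspace ?T \<inter> (U i \<times> {0..1}) \<inter> (U j \<times> {0..1})"
    then show "H i x = H j x"
      using disj by (metis IntD1 IntD2 SigmaE IntI empty_iff mem_Sigma_iff)
  next
    fix x assume "x \<in> topspace ?T"
    then show "\<exists>j. j \<in> I \<and> x \<in> U j \<times> {0..1} \<and> H (idx (fst x)) x = H j x"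
      using idx by auto
  qed
  moreover have "H (idx (fst (p, 0))) (p, 0) = fst p \<and> H (idx (fst (p, 1))) (p, 1) = snd p"
    if p: "p \<in> (\<Union>i\<in>I. U i)" for p
  proof -
    obtain i where "i \<in> I" "p \<in> U i"
      using p by blast
    then show ?thesis
      using H(2)[of i p] idx[of i p] by simp
  qed
  ultimately show ?thesis
    unfolding planner_def by blast
qed

section \<open>Disjoint open families from point-finite covers of a metrizable space\<close>

text \<open>With \<open>f\<^sub>i x\<close> the distance from \<open>x\<close> to the complement of \<open>P i\<close>, the set \<open>D B\<close> consists of the points
  where every \<open>f\<^sub>b\<close> with \<open>b \<in> B\<close> exceeds, by a uniform margin, every \<open>f\<^sub>c\<close> with \<open>c \<notin> B\<close>. Since the distances
  are 1-Lipschitz, \<open>D B\<close> is open without any local finiteness; closed balls replace distances to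
  avoid an empty complement.\<close>

lemma metrizable_disjoint_refinement:
  fixes P :: "'i \<Rightarrow> 'a set" and I :: "'i set"
  assumes "metrizable_space T"
    and op: "\<And>i. i \<in> I \<Longrightarrow> openin T (P i)"
    and fin: "\<And>x. x \<in> topspace T \<Longrightarrow>
        finite {i \<in> I. x \<in> P i} \<and> {i \<in> I. x \<in> P i} \<noteq> {} \<and> card {i \<in> I. x \<in> P i} \<le> m"
  obtains D
  where "\<And>B. B \<subseteq> I \<Longrightarrow> openin T (D B)"
    "\<And>B b. b \<in> B \<Longrightarrow> D B \<subseteq> P b"
    "\<And>B C. \<lbrakk>B \<subseteq> I; C \<subseteq> I; finite B; finite C; card B = card C; B \<noteq> C\<rbrakk> \<Longrightarrow> D B \<inter> D C = {}"
    "\<And>x. x \<in> topspace T \<Longrightarrow> \<exists>B\<subseteq>I. finite B \<and> B \<noteq> {} \<and> card B \<le> m \<and> x \<in> D B"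
proof -
  obtain M d where "Metric_space M d" and T: "T = Metric_space.mtopology M d"
    using assms(1) unfolding metrizable_space_def by blast
  interpret Metric_space M d by fact
  \<comment> \<open>Here \<open>r\<close> is the threshold and \<open>e\<close> the margin: the
    first condition bounds the distances for \<open>B\<close> below by \<open>r + e\<close>, the
    second bounds all others above by \<open>r\<close>.\<close>
  define D where "D = (\<lambda>B. {x \<in> M. \<exists>r\<ge>0. \<exists>e>0.
     (\<forall>b\<in>B. mcball x (r + e) \<subseteq> P b) \<and> (\<forall>c\<in>I - B. \<not> mcball x r \<subseteq> P c)})"
  show ?thesis
  proof
    fix B assume "B \<subseteq> I"
    show "openin T (D B)"
      unfolding T openin_mtopology
    proof (intro conjI allI impI)
      show "D B \<subseteq> M" by (auto simp: D_def)
      fix x assume "x \<in> D B"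
      then obtain r e where x: "x \<in> M" "r \<ge> 0" "e > 0"
        "\<And>b. b \<in> B \<Longrightarrow> mcball x (r + e) \<subseteq> P b" "\<And>c. c \<in> I - B \<Longrightarrow> \<not> mcball x r \<subseteq> P c"
        unfolding D_def by blast
      have "y \<in> D B" if y: "y \<in> mball x (e / 3)" for y
      proof -
        have yM: "y \<in> M" and dxy: "d x y < e / 3"
          using y by auto
        \<comment> \<open>Moving from \<open>x\<close> to \<open>y\<close> by less than
          \<open>e / 3\<close> uses up one third of the gap between \<open>r\<close> and
          \<open>r + e\<close> at each end. The middle third survives, with threshold
          \<open>r + e / 3\<close> and margin \<open>e / 3\<close>.\<close>
        have "mcball y (r + e / 3 + e / 3) \<subseteq> mcball x (r + e)"
          by (rule mcball_subset) (use yM x(1) dxy commute[of x y] in auto)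
        moreover have "mcball x r \<subseteq> mcball y (r + e / 3)"
          by (rule mcball_subset) (use yM x(1) dxy commute[of x y] in auto)
        ultimately have "(\<forall>b\<in>B. mcball y ((r + e / 3) + e / 3) \<subseteq> P b) \<and>
            (\<forall>c\<in>I - B. \<not> mcball y (r + e / 3) \<subseteq> P c)"
          using x(4,5) by blast
        moreover have "r + e / 3 \<ge> 0" "e / 3 > 0"
          using x(2,3) by auto
        ultimately show ?thesis
          using yM unfolding D_def by blast
      qed
      then show "\<exists>r>0. mball x r \<subseteq> D B"
        using x(3) by (intro exI[of _ "e / 3"]) auto
    qed
  next
    fix B and b :: 'i assume "b \<in> B"
    then show "D B \<subseteq> P b"
      unfolding D_def using centre_in_mcball_iff by fastforce
  next
    fix B C :: "'i set"
    assume BC: "B \<subseteq> I" "C \<subseteq> I" "finite B" "finite C" "card B = card C" "B \<noteq> C"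
    \<comment> \<open>Distinct finite sets of equal size are incomparable, so each has an element
      outside the other. A common point would then need the distance for \<open>b\<close> to exceed
      that for \<open>c\<close> and conversely.\<close>
    then obtain b c where bc: "b \<in> B" "b \<notin> C" "c \<in> C" "c \<notin> B"
      by (metis card_subset_eq subsetI)
    show "D B \<inter> D C = {}"
    proof (rule ccontr)
      assume "D B \<inter> D C \<noteq> {}"
      then obtain x where xB: "x \<in> D B" and xC: "x \<in> D C"
        by blast
      have "c \<in> I - B" "b \<in> I - C"
        using bc BC(1,2) by auto
      obtain r e where re: "e > 0" "mcball x (r + e) \<subseteq> P b" "\<not> mcball x r \<subseteq> P c"
        using xB \<open>b \<in> B\<close> \<open>c \<in> I - B\<close> unfolding D_def by blast
      obtain r' e' where re': "e' > 0" "mcball x (r' + e') \<subseteq> P c" "\<not> mcball x r' \<subseteq> P b"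
        using xC \<open>c \<in> C\<close> \<open>b \<in> I - C\<close> unfolding D_def by blast
      have "\<not> r' \<le> r + e"
        using mcball_subset_concentric[of r' "r + e" x] re(2) re'(3) by blast
      moreover have "\<not> r \<le> r' + e'"
        using mcball_subset_concentric[of r "r' + e'" x] re'(2) re(3) by blast
      ultimately show False
        using re(1) re'(1) by linarith
    qed
  next
    fix x assume x: "x \<in> topspace T"
    \<comment> \<open>With all indices whose set contains \<open>x\<close> collected in
      \<open>B\<close>, the threshold 0 works: the ball of radius 0 is the point \<open>x\<close>
      itself, which lies in no other \<open>P c\<close>.\<close>
    define B where "B = {i \<in> I. x \<in> P i}"
    have B: "finite B" "B \<noteq> {}" "card B \<le> m"
      using fin[OF x] by (auto simp: B_def)
    have "openin mtopology (\<Inter>b\<in>B. P b)"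
      using B op unfolding T by (intro openin_INT2) (auto simp: B_def)
    moreover have "x \<in> (\<Inter>b\<in>B. P b)"
      by (auto simp: B_def)
    ultimately obtain e where "e > 0" "mcball x e \<subseteq> (\<Inter>b\<in>B. P b)"
      unfolding openin_mtopology_mcball by blast
    moreover have "\<not> mcball x 0 \<subseteq> P c" if "c \<in> I - B" for c
      using that x by (auto simp: B_def T)
    ultimately have "x \<in> D B"
      using x unfolding D_def T by (intro CollectI conjI exI[of _ 0] exI[of _ e]) auto
    then show "\<exists>B\<subseteq>I. finite B \<and> B \<noteq> {} \<and> card B \<le> m \<and> x \<in> D B"
      using B by (intro exI[of _ B]) (auto simp: B_def)
  qed
qed

section \<open>Extending motion planners to open sets when X is an ENR\<close>

text \<open>Conjugation: pull both endpoints back by \<open>g\<close>, follow \<open>H\<close>, and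
  push the path forward by \<open>h\<close>. The extension lemma below uses this once in each
  direction of a homeomorphism.\<close>

lemma planner_homeomorphic_image:
  assumes h: "continuous_map X Z h" and g: "continuous_map Z X g"
    and hg: "\<And>x. x \<in> topspace X \<Longrightarrow> g (h x) = x"
    and U: "U \<subseteq> topspace (prod_topology X X)" and pl: "planner X U"
  shows "planner Z (map_prod h h ` U)"
proof -
  let ?I = "top_of_set {0..1::real}"
  obtain H where H: "continuous_map (prod_topology (subtopology (prod_topology X X) U) ?I) X H"
    "\<forall>p\<in>U. H (p, 0) = fst p \<and> H (p, 1) = snd p"
    using pl unfolding planner_def by blast
  have gU: "map_prod g g p \<in> U" if "p \<in> map_prod h h ` U" for p
    using that U hg by (auto simp: subset_iff)
  have "continuous_map (prod_topology Z Z) (prod_topology X X) (map_prod g g)"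
    using g by (simp add: map_prod_def continuous_map_prod_top)
  then have "continuous_map (subtopology (prod_topology Z Z) (map_prod h h ` U))
      (subtopology (prod_topology X X) U) (map_prod g g)"
    using gU by (auto simp: continuous_map_in_subtopology intro: continuous_map_from_subtopology)
  then have "continuous_map (prod_topology (subtopology (prod_topology Z Z) (map_prod h h ` U)) ?I)
      (prod_topology (subtopology (prod_topology X X) U) ?I) (\<lambda>(z, t). (map_prod g g z, t))"
    by (simp add: continuous_map_prod_top)
  from continuous_map_compose[OF continuous_map_compose[OF this H(1)] h]
  have "continuous_map (prod_topology (subtopology (prod_topology Z Z) (map_prod h h ` U)) ?I) Z
      (\<lambda>(z, t). h (H (map_prod g g z, t)))"
    by (simp add: o_def case_prod_unfold)
  moreover have "h (H (map_prod g g z, 0)) = fst z \<and> h (H (map_prod g g z, 1)) = snd z"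
    if z: "z \<in> map_prod h h ` U" for z
  proof -
    from z obtain p where p: "z = map_prod h h p" "p \<in> U"
      by (rule imageE)
    then have "map_prod g g z = p"
      using U hg by (cases p) auto
    then show ?thesis
      using H(2) p by simp
  qed
  ultimately show ?thesis
    unfolding planner_def by (intro exI[of _ "\<lambda>(z, t). h (H (map_prod g g z, t))"]) simp
qed

text \<open>The homotopy on \<open>U \<times> [0,1]\<close> is extended together with the two projections on \<open>Q \<times> {0,1}\<close>, where
  \<open>Q\<close> is open and \<open>U\<close> is closed in \<open>Q\<close>; the extension then keeps the right ends over all of \<open>W\<close>.\<close>

lemma planner_extend_ENR:
  fixes S :: "'e::euclidean_space set"
  assumes "ENR S" and A: "closedin (top_of_set (S \<times> S)) A"
    and U: "openin (top_of_set A) U" and pl: "planner (top_of_set S) U"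
  obtains W where "openin (top_of_set (S \<times> S)) W" "U \<subseteq> W" "planner (top_of_set S) W"
proof -
  have ASS: "A \<subseteq> S \<times> S"
    using A closedin_imp_subset by blast
  obtain V0 where V0: "open V0" "U = A \<inter> V0"
    using U unfolding openin_open by blast
  \<comment> \<open>\<open>U\<close> is only relatively open in \<open>A\<close>, so it may fail to
    be closed in \<open>S \<times> S\<close>. Inside the open set \<open>Q\<close> it is closed, as
    the extensor property of ANRs demands.\<close>
  define Q where "Q = (S \<times> S) \<inter> V0"
  have Q: "openin (top_of_set (S \<times> S)) Q" "Q \<subseteq> S \<times> S"
    using V0 unfolding Q_def by auto
  have UQ: "U \<subseteq> Q" "U = Q \<inter> A" "U \<subseteq> S \<times> S"
    using V0 ASS by (auto simp: Q_def)
  have cloU: "closedin (top_of_set Q) U"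
    by (metis A Q(2) UQ(2) closedin_closed_subset inf.commute)
  have "subtopology (prod_topology (top_of_set S) (top_of_set S)) U = top_of_set U"
    using UQ(3) by (simp add: subtopology_subtopology inf.absorb2)
  then obtain H where H: "continuous_on (U \<times> {0..1::real}) H" "H ` (U \<times> {0..1}) \<subseteq> S"
    "\<forall>p\<in>U. H (p, 0) = fst p \<and> H (p, 1) = snd p"
    using pl unfolding planner_def by auto
  define L where "L = (Q \<times> {0}) \<union> (Q \<times> {1::real})"
  define T where "T = (U \<times> {0..1::real}) \<union> L"
  \<comment> \<open>The clauses agree where their domains meet, since over \<open>U\<close> the
    homotopy \<open>H\<close> starts at \<open>fst p\<close> and ends at \<open>snd p\<close>. Hence
    \<open>F\<close> is continuous on the union \<open>T\<close> of three closed pieces.\<close>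
  define F where "F = (\<lambda>z. if snd z = 0 then fst (fst z) else if snd z = 1 then snd (fst z) else H z)"
  have clo0: "closedin (top_of_set (Q \<times> {0..1::real})) (U \<times> {0..1})"
    using cloU by (simp add: closedin_Times)
  have clo1: "closedin (top_of_set (Q \<times> {0..1::real})) (Q \<times> {0})"
    "closedin (top_of_set (Q \<times> {0..1::real})) (Q \<times> {1})"
    by (auto intro!: closedin_Times)
  have TQ: "T \<subseteq> Q \<times> {0..1}"
    using UQ(1) by (auto simp: T_def L_def)
  have cloT: "closedin (top_of_set (Q \<times> {0..1::real})) T"
    unfolding T_def L_def by (intro closedin_Un clo0 clo1)
  have "continuous_on L F"
    unfolding L_def
  proof (rule continuous_on_Un_local)
    show "closedin (top_of_set (Q \<times> {0} \<union> Q \<times> {1::real})) (Q \<times> {0})"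
      by (rule closedin_subset_trans[OF clo1(1)]) auto
    show "closedin (top_of_set (Q \<times> {0} \<union> Q \<times> {1::real})) (Q \<times> {1})"
      by (rule closedin_subset_trans[OF clo1(2)]) auto
    show "continuous_on (Q \<times> {0}) F"
      by (rule continuous_on_eq[of _ "\<lambda>z. fst (fst z)"]) (auto simp: F_def intro!: continuous_intros)
    show "continuous_on (Q \<times> {1}) F"
      by (rule continuous_on_eq[of _ "\<lambda>z. snd (fst z)"]) (auto simp: F_def intro!: continuous_intros)
  qed
  moreover have "continuous_on (U \<times> {0..1}) F"
    by (rule continuous_on_eq[OF H(1)]) (use H(3) in \<open>auto simp: F_def\<close>)
  ultimately have contF: "continuous_on T F"
    unfolding T_def
  proof (intro continuous_on_Un_local)
    show "closedin (top_of_set (U \<times> {0..1} \<union> L)) (U \<times> {0..1})"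
      by (rule closedin_subset_trans[OF clo0]) (use TQ in \<open>auto simp: T_def\<close>)
    show "closedin (top_of_set (U \<times> {0..1} \<union> L)) L"
      by (rule closedin_subset_trans[of "Q \<times> {0..1}"]) (use TQ in \<open>auto simp: T_def L_def intro!: closedin_Un clo1\<close>)
  qed
  have FS: "F \<in> T \<rightarrow> S"
  proof (rule Pi_I)
    fix z assume "z \<in> T"
    then consider p t where "z = (p, t)" "p \<in> U" "t \<in> {0..1}" | p where "z = (p, 0)" "p \<in> Q"
      | p where "z = (p, 1)" "p \<in> Q"
      by (auto simp: T_def L_def)
    then show "F z \<in> S"
    proof cases
      case 1
      then have "H z \<in> S" "fst p \<in> S" "snd p \<in> S"
        using H(2) UQ(3) by (auto simp: image_subset_iff mem_Times_iff)
      then show ?thesis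
        using 1 by (simp add: F_def)
    qed (use Q(2) in \<open>auto simp: F_def mem_Times_iff\<close>)
  qed
  obtain V G where V: "T \<subseteq> V" "openin (top_of_set (Q \<times> {0..1})) V"
    and G: "continuous_on V G" "G \<in> V \<rightarrow> S" "\<And>z. z \<in> T \<Longrightarrow> G z = F z"
    using ANR_imp_absolute_neighbourhood_extensor[OF ENR_imp_ANR[OF \<open>ENR S\<close>] contF FS cloT] by blast
  \<comment> \<open>The extension \<open>G\<close> lives on a neighbourhood \<open>V\<close> of
    \<open>T\<close> that need not be a cylinder. \<open>W\<close> collects the points whose whole
    time interval lies in \<open>V\<close>; compactness of [0,1] makes it open.\<close>
  define W where "W = {p \<in> Q. {p} \<times> {0..1::real} \<subseteq> V}"
  have WQ: "W \<subseteq> Q"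
    by (auto simp: W_def)
  have "openin (top_of_set Q) W"
  proof (subst openin_subopen, intro ballI)
    fix p assume p: "p \<in> W"
    have "\<exists>A B. openin (top_of_set Q) A \<and> openin (top_of_set {0..1::real}) B \<and> p \<in> A \<and>
        {0..1} \<subseteq> B \<and> A \<times> B \<subseteq> V"
      by (rule tube_lemma_right) (use p V(2) in \<open>auto simp: W_def compactin_subtopology\<close>)
    then obtain A B where AB: "openin (top_of_set Q) A" "p \<in> A" "{0..1::real} \<subseteq> B" "A \<times> B \<subseteq> V"
      by blast
    moreover have "A \<subseteq> W"
      using AB openin_imp_subset[OF AB(1)] by (auto simp: W_def)
    ultimately show "\<exists>A. openin (top_of_set Q) A \<and> p \<in> A \<and> A \<subseteq> W"
      by blast
  qed
  then have "openin (top_of_set (S \<times> S)) W"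
    using Q(1) openin_trans by blast
  moreover have "U \<subseteq> W"
    using UQ(1) V(1) by (auto simp: W_def T_def)
  moreover have "planner (top_of_set S) W"
  proof -
    have "subtopology (prod_topology (top_of_set S) (top_of_set S)) W = top_of_set W"
      using WQ Q(2) by (simp add: subtopology_subtopology inf.absorb2)
    moreover have WV: "W \<times> {0..1} \<subseteq> V"
      by (auto simp: W_def)
    moreover have "G (p, 0) = fst p \<and> G (p, 1) = snd p" if "p \<in> W" for p
      using that G(3)[of "(p, 0)"] G(3)[of "(p, 1)"] WQ by (auto simp: T_def L_def F_def)
    ultimately show ?thesis
      unfolding planner_def using continuous_on_subset[OF G(1) WV] G(2)
      by (intro exI[of _ G]) auto
  qed
  ultimately show ?thesis
    using that by blast
qed

text \<open>Everything is carried to the Euclidean model \<open>S\<close> by \<open>h\<close> on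
  both factors, extended there, and carried back by \<open>g\<close>.\<close>

lemma planner_extend:
  fixes S :: "'e::euclidean_space set"
  assumes hom: "X homeomorphic_space top_of_set S" and "ENR S"
    and A: "closedin (prod_topology X X) A"
    and U: "openin (subtopology (prod_topology X X) A) U" and pl: "planner X U"
  obtains W where "openin (prod_topology X X) W" "U \<subseteq> W" "planner X W"
proof -
  obtain h g where hg: "homeomorphic_maps X (top_of_set S) h g"
    using hom unfolding homeomorphic_space_def by blast
  then have h: "continuous_map X (top_of_set S) h" and g: "continuous_map (top_of_set S) X g"
    and gh: "\<And>x. x \<in> topspace X \<Longrightarrow> g (h x) = x" and hg': "\<And>x. x \<in> S \<Longrightarrow> h (g x) = x"
    by (auto simp: homeomorphic_maps_def)
  let ?XX = "prod_topology X X" and ?hh = "map_prod h h" and ?gg = "map_prod g g"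
  have "homeomorphic_maps ?XX (top_of_set (S \<times> S)) ?hh ?gg"
    using h g gh hg' unfolding homeomorphic_maps_def map_prod_def
    by (auto simp: continuous_map_prod_top simp flip: prod_topology_subtopology_eu)
  then have hh: "homeomorphic_map ?XX (top_of_set (S \<times> S)) ?hh"
    and gg: "homeomorphic_map (top_of_set (S \<times> S)) ?XX ?gg"
    using homeomorphic_maps_map by blast+
  have Asub: "A \<subseteq> topspace ?XX"
    using A closedin_subset by blast
  obtain V where V: "openin ?XX V" "U = V \<inter> A"
    using U unfolding openin_subtopology by blast
  have Usub: "U \<subseteq> topspace ?XX"
    using V Asub by blast
  have inj: "inj_on ?hh (topspace ?XX)"
    using gh by (intro inj_on_inverseI[where g = ?gg]) auto
  have hV: "openin (top_of_set (S \<times> S)) (?hh ` V)"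
    using homeomorphic_map_openness_eq[OF hh] V(1) by simp
  have hU: "?hh ` U = ?hh ` A \<inter> ?hh ` V"
    using inj_on_image_Int[OF inj openin_subset[OF V(1)] Asub] V(2) by (simp only: Int_commute)
  have hA: "?hh ` A \<subseteq> S \<times> S"
    using image_mono[OF Asub, of ?hh] homeomorphic_imp_surjective_map[OF hh] by simp
  obtain V' where V': "open V'" "?hh ` V = S \<times> S \<inter> V'"
    using hV by (auto simp: openin_open)
  have "?hh ` U = ?hh ` A \<inter> V'"
    unfolding hU V'(2) using hA by (simp add: Int_assoc[symmetric] inf.absorb1)
  then have "openin (top_of_set (?hh ` A)) (?hh ` U)"
    using V'(1) openin_open_Int by simp
  moreover have "closedin (top_of_set (S \<times> S)) (?hh ` A)"
    using homeomorphic_map_closedness_eq[OF hh] A by simp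
  moreover have "planner (top_of_set S) (?hh ` U)"
    by (rule planner_homeomorphic_image[OF h g gh Usub pl])
  ultimately obtain W where W: "openin (top_of_set (S \<times> S)) W" "?hh ` U \<subseteq> W" "planner (top_of_set S) W"
    using planner_extend_ENR[OF \<open>ENR S\<close>] by blast
  have WS: "W \<subseteq> S \<times> S"
    using W(1) openin_imp_subset by blast
  show ?thesis
  proof
    show "openin ?XX (?gg ` W)"
      using homeomorphic_map_openness_eq[OF gg] W(1) WS by auto
    have "p \<in> ?gg ` W" if "p \<in> U" for p
    proof
      show "p = ?gg (?hh p)"
        using that Usub gh by (cases p) auto
      show "?hh p \<in> W"
        using that W(2) by blast
    qed
    then show "U \<subseteq> ?gg ` W"
      by blast
    show "planner X (?gg ` W)"
      by (rule planner_homeomorphic_image[OF g h]) (use hg' WS W(3) in auto)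
  qed
qed

section \<open>From the numerical invariants to covers and back\<close>

text \<open>Enumerating an arbitrary finite index set makes it possible to index the final cover by
  pairs.\<close>

lemma subspace_TC_leI:
  fixes X :: "'a topology"
  assumes "finite I" "(\<Union>i\<in>I. U i) = A" "A \<subseteq> topspace (prod_topology X X)"
    and "\<And>i. i \<in> I \<Longrightarrow> openin (subtopology (prod_topology X X) A) (U i)"
    and "\<And>i. i \<in> I \<Longrightarrow> planner X (U i)"
  shows "subspace_TC X A \<le> enat (card I)"
proof -
  obtain f where f: "bij_betw f {..<card I} I"
    using ex_bij_betw_nat_finite[OF assms(1)] by (auto simp: atLeast0LessThan)
  have sec: "\<exists>s. continuous_map (subtopology (prod_topology X X) (U i)) (path_space X) s \<and>
      (\<forall>p\<in>U i. endpoints (s p) = p)" if "i \<in> I" for i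
    using that assms(2,3,5) planner_iff_section[of "U i" X] by blast
  have "(\<Union>i<card I. U (f i)) = A"
    using assms(2) f by (metis bij_betw_imp_surj_on image_image)
  moreover have "f i \<in> I" if "i < card I" for i
    using f that by (auto simp: bij_betw_def)
  ultimately have "\<exists>V :: nat \<Rightarrow> ('a \<times> 'a) set. (\<Union>i<card I. V i) = A \<and>
      (\<forall>i<card I. openin (subtopology (prod_topology X X) A) (V i) \<and>
        (\<exists>s. continuous_map (subtopology (prod_topology X X) (V i)) (path_space X) s \<and>
          (\<forall>p\<in>V i. endpoints (s p) = p)))"
    using assms(4) sec by (intro exI[of _ "\<lambda>i. U (f i)"]) simp
  then show ?thesis
    unfolding subspace_TC_def by (intro Inf_lower CollectI exI[of _ "card I"] conjI refl)
qed

text \<open>A finite bound rules out the empty infimum, so some cover realises the value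
  \<open>k\<close>. Padding by empty sets brings its length to exactly \<open>n\<close>, a number
  common to all fibres.\<close>

lemma subspace_TC_leD:
  fixes X :: "'a topology"
  assumes "subspace_TC X A \<le> enat n" and A: "A \<subseteq> topspace (prod_topology X X)"
  obtains U where "(\<Union>i<n. U i) = A"
    "\<And>i. i < n \<Longrightarrow> openin (subtopology (prod_topology X X) A) (U i)"
    "\<And>i. i < n \<Longrightarrow> planner X (U i)"
proof -
  let ?K = "{enat k | k. \<exists>U :: nat \<Rightarrow> ('a \<times> 'a) set.
        (\<Union>i<k. U i) = A \<and>
        (\<forall>i<k. openin (subtopology (prod_topology X X) A) (U i) \<and>
           (\<exists>s. continuous_map (subtopology (prod_topology X X) (U i)) (path_space X) s \<and>
                (\<forall>p \<in> U i. endpoints (s p) = p)))}"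
  have "Inf ?K \<le> enat n"
    using assms(1) unfolding subspace_TC_def .
  then have "Inf ?K \<in> ?K"
    by (metis (no_types, lifting) Inf_enat_def LeastI enat_ord_simps(5) ex_in_conv infinity_ileE)
  then obtain k U where k: "Inf ?K = enat k" and U: "(\<Union>i<k. U i) = A"
    "\<And>i. i < k \<Longrightarrow> openin (subtopology (prod_topology X X) A) (U i)"
    "\<And>i. i < k \<Longrightarrow> \<exists>s. continuous_map (subtopology (prod_topology X X) (U i)) (path_space X) s \<and>
                (\<forall>p \<in> U i. endpoints (s p) = p)"
    by blast
  have "k \<le> n"
    using k \<open>Inf ?K \<le> enat n\<close> by simp
  show ?thesis
  proof
    show "(\<Union>i<n. if i < k then U i else {}) = A"
    proof -
      have "(\<Union>i<n. if i < k then U i else {}) = (\<Union>i\<in>{..<n} \<inter> {..<k}. U i)"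
        by auto
      also have "{..<n} \<inter> {..<k} = {..<k}"
        using \<open>k \<le> n\<close> by auto
      finally show ?thesis
        using U(1) by simp
    qed
    show "openin (subtopology (prod_topology X X) A) (if i < k then U i else {})" if "i < n" for i
      using U(2) by simp
    show "planner X (if i < k then U i else {})" if "i < n" for i
    proof (cases "i < k")
      case True
      then have "U i \<subseteq> topspace (prod_topology X X)"
        using U(1) A by blast
      then show ?thesis
        using True U(3)[OF True] planner_iff_section[of "U i" X] by simp
    qed (simp add: planner_empty)
  qed
qed

lemma covering_dimD:
  assumes "covering_dim Y = enat d" "open_cover_of Y \<U>"
  obtains \<V> where "open_cover_of Y \<V>" "refines \<V> \<U>"
    "\<And>y. y \<in> topspace Y \<Longrightarrow> finite {V \<in> \<V>. y \<in> V} \<and> card {V \<in> \<V>. y \<in> V} \<le> d + 1"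
proof -
  let ?K = "{enat d | d. \<forall>\<U>. open_cover_of Y \<U> \<longrightarrow>
        (\<exists>\<V>. open_cover_of Y \<V> \<and> refines \<V> \<U> \<and>
             (\<forall>y \<in> topspace Y. finite {V \<in> \<V>. y \<in> V} \<and> card {V \<in> \<V>. y \<in> V} \<le> d + 1))}"
  have "Inf ?K = enat d"
    using assms(1) unfolding covering_dim_def .
  then have "enat d \<in> ?K"
    by (metis (no_types, lifting) Inf_enat_def LeastI enat.distinct(1) ex_in_conv)
  then show ?thesis
    using assms(2) that by blast
qed

section \<open>The product bound\<close>

theorem theorem1p2:
  fixes X :: "'a topology" and Y :: "'b topology"
    and S :: "'e::euclidean_space set"
    and q :: "'a \<times> 'a \<Rightarrow> 'b" and n :: nat
  assumes "path_connected_space X"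
    and "normal_space X"
    and "X homeomorphic_space top_of_set S" and "ENR S"
    and "continuous_map (prod_topology X X) Y q"
    and "closed_map (prod_topology X X) Y q"
    and "paracompact_space Y"
    and "\<And>y. y \<in> topspace Y \<Longrightarrow>
           subspace_TC X {p \<in> topspace (prod_topology X X). q p = y} \<le> enat n"
  shows "TC X \<le> (covering_dim Y + 1) * enat n"
proof -
  let ?XX = "prod_topology X X"
  define Fib where "Fib y = {p \<in> topspace ?XX. q p = y}" for y
  have "metrizable_space X"
    using homeomorphic_metrizable_space[OF assms(3)]
    by (simp add: metrizable_space_euclidean metrizable_space_subtopology)
  \<comment> \<open>Metrizability of X x X serves twice: points are closed, and the cover pulled
    back from \<open>Y\<close> can be regrouped into disjoint families.\<close>
  then have met: "metrizable_space ?XX"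
    by (simp add: metrizable_space_prod_topology)
  have qY: "q p \<in> topspace Y" if "p \<in> topspace ?XX" for p
    using continuous_map_image_subset_topspace[OF assms(5)] that by (rule subsetD[OF _ imageI])
  have closed_Fib: "closedin ?XX (Fib y)" for y
  proof (cases "Fib y = {}")
    case False
    then obtain p where p: "p \<in> topspace ?XX" "q p = y"
      by (auto simp: Fib_def)
    have "closedin ?XX {p}"
      using metrizable_imp_t1_space[OF met] p(1) unfolding t1_space_closedin_singleton by blast
    then have "closedin Y {y}"
      using assms(6) p(2) unfolding closed_map_def by (metis image_empty image_insert)
    from closedin_continuous_map_preimage[OF assms(5) this] show ?thesis
      by (simp add: Fib_def)
  qed simp
  have "\<exists>W :: nat \<Rightarrow> ('a \<times> 'a) set. (\<forall>i<n. openin ?XX (W i) \<and> planner X (W i)) \<and> Fib y \<subseteq> (\<Union>i<n. W i)"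
    if y: "y \<in> topspace Y" for y
  proof -
    obtain U where U: "(\<Union>i<n. U i) = Fib y"
      "\<And>i. i < n \<Longrightarrow> openin (subtopology ?XX (Fib y)) (U i)" "\<And>i. i < n \<Longrightarrow> planner X (U i)"
      by (rule subspace_TC_leD[OF assms(8)[OF y, folded Fib_def] closedin_subset[OF closed_Fib]]) (rule that)
    have "\<exists>W. openin ?XX W \<and> U i \<subseteq> W \<and> planner X W" if "i < n" for i
      by (rule planner_extend[OF assms(3,4) closed_Fib U(2)[OF that] U(3)[OF that]]) blast
    then obtain W where "\<And>i. i < n \<Longrightarrow> openin ?XX (W i) \<and> U i \<subseteq> W i \<and> planner X (W i)"
      by metis
    then show ?thesis
      using U(1) by (intro exI[of _ W]) blast
  qed
  then obtain W :: "'b \<Rightarrow> nat \<Rightarrow> ('a \<times> 'a) set"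
    where W: "\<And>y i. \<lbrakk>y \<in> topspace Y; i < n\<rbrakk> \<Longrightarrow> openin ?XX (W y i) \<and> planner X (W y i)"
      "\<And>y. y \<in> topspace Y \<Longrightarrow> Fib y \<subseteq> (\<Union>i<n. W y i)"
    by metis
  \<comment> \<open>The largest part of \<open>Y\<close> whose preimage lies in the union of the
    \<open>W y i\<close>. It contains \<open>y\<close> because the fibre does lie there, and it is
    open because \<open>q\<close> maps the closed complement of the union to a closed set.\<close>
  define N where "N y = topspace Y - q ` (topspace ?XX - (\<Union>i<n. W y i))" for y
  have cover_N: "open_cover_of Y (N ` topspace Y)"
    unfolding open_cover_of_def
  proof (intro conjI ballI antisym)
    fix A assume "A \<in> N ` topspace Y"
    then obtain y where y: "y \<in> topspace Y" "A = N y"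
      by blast
    have "closedin ?XX (topspace ?XX - (\<Union>i<n. W y i))"
      using W(1)[OF y(1)] by (intro closedin_diff closedin_topspace openin_Union) auto
    then show "openin Y A"
      using assms(6) y(2) unfolding closed_map_def N_def by blast
  next
    show "topspace Y \<subseteq> \<Union> (N ` topspace Y)"
      using W(2) unfolding N_def Fib_def by blast
  qed (auto simp: N_def)
  show ?thesis
  proof (cases "covering_dim Y")
    case infinity
    show ?thesis
    \<comment> \<open>For \<open>n = 0\<close> the right-hand side is infinity times 0, which is 0
      in \<open>enat\<close>, so it must be shown that X x X is empty: all fibres are covered by no
      sets at all.\<close>
    proof (cases "n = 0")
      case True
      then have "p \<notin> topspace ?XX" for p
        using W(2)[of "q p"] qY[of p] unfolding Fib_def by blast
      then have "(\<Union>i\<in>({} :: nat set). {}) = topspace ?XX"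
        by blast
      then have "subspace_TC X (topspace ?XX) \<le> enat (card ({} :: nat set))"
        by (rule subspace_TC_leI[OF finite.emptyI]) auto
      then show ?thesis
        by (simp add: TC_def True flip: zero_enat_def)
    qed (simp add: infinity imult_is_infinity flip: zero_enat_def)
  next
    case (enat d)
    obtain \<V> where V: "open_cover_of Y \<V>" "refines \<V> (N ` topspace Y)"
      "\<And>y. y \<in> topspace Y \<Longrightarrow> finite {V \<in> \<V>. y \<in> V} \<and> card {V \<in> \<V>. y \<in> V} \<le> d + 1"
      by (rule covering_dimD[OF enat cover_N]) (rule that)
    define P where "P V = {p \<in> topspace ?XX. q p \<in> V}" for V
    have "\<exists>y\<in>topspace Y. V \<subseteq> N y" if "V \<in> \<V>" for V
      using V(2) that unfolding refines_def by blast
    then obtain c where c: "\<And>V. V \<in> \<V> \<Longrightarrow> c V \<in> topspace Y \<and> V \<subseteq> N (c V)"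
      by metis
    have P_sub: "P V \<subseteq> (\<Union>i<n. W (c V) i)" if "V \<in> \<V>" for V
      using c[OF that] unfolding P_def N_def by blast
    have P_open: "openin ?XX (P V)" if "V \<in> \<V>" for V
      using openin_continuous_map_preimage[OF assms(5)] V(1) that
      unfolding P_def open_cover_of_def by blast
    have P_fin: "finite {V \<in> \<V>. p \<in> P V} \<and> {V \<in> \<V>. p \<in> P V} \<noteq> {} \<and> card {V \<in> \<V>. p \<in> P V} \<le> d + 1"
      if "p \<in> topspace ?XX" for p
    proof -
      have "{V \<in> \<V>. p \<in> P V} = {V \<in> \<V>. q p \<in> V}"
        using that by (auto simp: P_def)
      then show ?thesis
        using V(1) V(3)[OF qY[OF that]] qY[OF that] unfolding open_cover_of_def by auto
    qed
    obtain D where D: "\<And>B. B \<subseteq> \<V> \<Longrightarrow> openin ?XX (D B)" "\<And>B b. b \<in> B \<Longrightarrow> D B \<subseteq> P b"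
      "\<And>B C. \<lbrakk>B \<subseteq> \<V>; C \<subseteq> \<V>; finite B; finite C; card B = card C; B \<noteq> C\<rbrakk> \<Longrightarrow> D B \<inter> D C = {}"
      "\<And>p. p \<in> topspace ?XX \<Longrightarrow> \<exists>B\<subseteq>\<V>. finite B \<and> B \<noteq> {} \<and> card B \<le> d + 1 \<and> p \<in> D B"
      by (rule metrizable_disjoint_refinement[OF met P_open P_fin]) (assumption | rule that)+
    \<comment> \<open>The shift by one lets \<open>j\<close> range over 0 to \<open>d\<close>,
      matching the sizes 1 to \<open>d + 1\<close> of the nonempty sets \<open>B\<close>.\<close>
    define \<B> where "\<B> j = {B. B \<subseteq> \<V> \<and> finite B \<and> card B = Suc j}" for j
    \<comment> \<open>Any member of \<open>B\<close> would do: \<open>D B\<close> lies in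
      \<open>P V\<close> for every \<open>V\<close> in \<open>B\<close>, hence in the union of the
      sets \<open>W\<close> at the point \<open>c V\<close> chosen for \<open>V\<close>.\<close>
    define y where "y B = c (SOME V. V \<in> B)" for B
    have some: "(SOME V. V \<in> B) \<in> B" if "B \<in> \<B> j" for B j
      using that unfolding some_in_eq \<B>_def by force
    have yY: "y B \<in> topspace Y" and DW: "D B \<subseteq> (\<Union>i<n. W (y B) i)" if "B \<in> \<B> j" for B j
    proof -
      have "(SOME V. V \<in> B) \<in> \<V>"
        using some[OF that] that by (auto simp: \<B>_def)
      then show "y B \<in> topspace Y" "D B \<subseteq> (\<Union>i<n. W (y B) i)"
        using c P_sub D(2)[OF some[OF that]] unfolding y_def by blast+
    qed
    \<comment> \<open>For fixed \<open>j\<close> the sets \<open>D B\<close> are pairwise disjoint,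
      so the \<open>i\<close>-th planners attached to the various \<open>B\<close> glue to one. The
      pairs \<open>(j, i)\<close> number \<open>(d + 1) * n\<close>.\<close>
    define U where "U = (\<lambda>(j, i). \<Union>B\<in>\<B> j. D B \<inter> W (y B) i)"
    have op: "openin ?XX (D B \<inter> W (y B) i)" if "B \<in> \<B> j" "i < n" for B i j
    proof (rule openin_Int)
      show "openin ?XX (D B)"
        using that(1) by (intro D(1)) (simp add: \<B>_def)
    qed (use W(1)[OF yY[OF that(1)] that(2)] in blast)
    have "subspace_TC X (topspace ?XX) \<le> enat (card ({..d} \<times> {..<n}))"
    proof (rule subspace_TC_leI)
      fix ji assume "ji \<in> {..d} \<times> {..<n}"
      then obtain j i where ji: "ji = (j, i)" "i < n"
        by blast
      show "openin (subtopology ?XX (topspace ?XX)) (U ji)"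
        unfolding U_def ji(1) subtopology_topspace prod.case
        using op[OF _ ji(2)] by (intro openin_Union) blast
      have "planner X (\<Union>B\<in>\<B> j. D B \<inter> W (y B) i)"
      proof (rule planner_disjoint_Union)
        fix B assume B: "B \<in> \<B> j"
        show "planner X (D B \<inter> W (y B) i)"
          using planner_mono W(1)[OF yY[OF B] ji(2)] by blast
      next
        fix B C assume "B \<in> \<B> j" "C \<in> \<B> j" "B \<noteq> C"
        then have "D B \<inter> D C = {}"
          by (intro D(3)) (auto simp: \<B>_def)
        then show "(D B \<inter> W (y B) i) \<inter> (D C \<inter> W (y C) i) = {}"
          by blast
      qed (use op ji in blast)
      then show "planner X (U ji)"
        by (simp add: U_def ji)
    next
      show "(\<Union>ji\<in>{..d} \<times> {..<n}. U ji) = topspace ?XX"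
      proof (intro antisym UN_least subsetI)
        fix ji p assume "ji \<in> {..d} \<times> {..<n}" "p \<in> U ji"
        then show "p \<in> topspace ?XX"
          using openin_subset[OF op] unfolding U_def by blast
      next
        fix p assume "p \<in> topspace ?XX"
        then obtain B where B: "B \<subseteq> \<V>" "finite B" "B \<noteq> {}" "card B \<le> d + 1" "p \<in> D B"
          using D(4) by blast
        define j where "j = card B - 1"
        have "card B > 0"
          using B by (simp add: card_gt_0_iff)
        then have j: "j \<le> d" "B \<in> \<B> j"
          using B by (auto simp: j_def \<B>_def)
        obtain i where "i < n" "p \<in> W (y B) i"
          using DW[OF j(2)] B(5) by blast
        then have "p \<in> U (j, i)" "(j, i) \<in> {..d} \<times> {..<n}"
          using j B(5) by (auto simp: U_def)
        then show "p \<in> (\<Union>ji\<in>{..d} \<times> {..<n}. U ji)"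
          by blast
      qed
    qed auto
    then show ?thesis
      by (simp add: TC_def enat one_enat_def)
  qed
qed

end
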